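(* A pre-Wajsberg algebra $(X,\to,^*,1)$ is a Wajsberg algebra if and only if, for all $x,y\in X$, $x\le y$ implies $x\le_Q y$.
   Context: A BE algebra is an algebra $(X,\to,1)$ of type $(2,0)$ such that for all $x,y,z\in X$: $x\to x=1$; $x\to 1=1$; $1\to x=x$; $x\to (y\to z)=y\to (x\to z)$. Write $x\le y$ iff $x\to y=1$. It is bounded if there is $0\in X$ with $0\le x$ for all $x\in X$; then $x^*:=x\to 0$. It is involutive if it is bounded and $x^{**}=x$ for all $x\in X$; an involutive BE algebra is denoted $(X,\to,^*,1)$. In an involutive BE algebra define $x\Cap y=((x^*\to y^* )\to y^* )^*$, and $x\le_Q y$ iff $x=x\Cap y$. A pre-Wajsberg algebra is an involutive BE algebra satisfying $x\to (x\Cap y)=x\to y$ for all $x,y$. A Wajsberg algebra is an algebra $(X,\to,^*,1)$ of type $(2,1,0)$ such that for all $x,y,z\in X$: $1\to x=x$; $(y\to z)\to ((z\to x)\to (y\to x))=1$; $(x\to y)\to y=(y\to x)\to x$; $(x^*\to y^* )\to (y\to x)=1$. *)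

theory Defs
  imports Main
begin

text \<open>An algebra is given by an explicit carrier set \<open>X\<close>, closed under operations on an
  ambient type; the axioms are imposed on \<open>X\<close> only.\<close>

definition be_le :: "('a \<Rightarrow> 'a \<Rightarrow> 'a) \<Rightarrow> 'a \<Rightarrow> 'a \<Rightarrow> 'a \<Rightarrow> bool"
  where "be_le imp one x y \<longleftrightarrow> imp x y = one"

definition q_meet :: "('a \<Rightarrow> 'a \<Rightarrow> 'a) \<Rightarrow> ('a \<Rightarrow> 'a) \<Rightarrow> 'a \<Rightarrow> 'a \<Rightarrow> 'a"
  where "q_meet imp star x y = star (imp (imp (star x) (star y)) (star y))"

definition q_le :: "('a \<Rightarrow> 'a \<Rightarrow> 'a) \<Rightarrow> ('a \<Rightarrow> 'a) \<Rightarrow> 'a \<Rightarrow> 'a \<Rightarrow> bool"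
  where "q_le imp star x y \<longleftrightarrow> x = q_meet imp star x y"

locale be_algebra =
  fixes X :: "'a set"
    and imp :: "'a \<Rightarrow> 'a \<Rightarrow> 'a"  (infixr "\<rightarrow>" 65)
    and one :: 'a  ("\<one>")
  assumes imp_closed: "\<lbrakk>x \<in> X; y \<in> X\<rbrakk> \<Longrightarrow> (x \<rightarrow> y) \<in> X"
    and one_closed: "\<one> \<in> X"
    and imp_refl: "x \<in> X \<Longrightarrow> (x \<rightarrow> x) = \<one>"
    and imp_one: "x \<in> X \<Longrightarrow> (x \<rightarrow> \<one>) = \<one>"
    and one_imp: "x \<in> X \<Longrightarrow> (\<one> \<rightarrow> x) = x"
    and imp_exchange:
      "\<lbrakk>x \<in> X; y \<in> X; z \<in> X\<rbrakk> \<Longrightarrow> (x \<rightarrow> (y \<rightarrow> z)) = (y \<rightarrow> (x \<rightarrow> z))"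

locale bounded_be_algebra = be_algebra +
  fixes zero :: 'a  ("\<zero>")
  assumes zero_closed: "\<zero> \<in> X"
    and zero_least: "x \<in> X \<Longrightarrow> be_le imp \<one> \<zero> x"

text \<open>In the signature \<open>(X, \<rightarrow>, \<^sup>*, 1)\<close> the bottom element is not named. It is
  nevertheless determined, since \<open>0 = 1 \<rightarrow> 0 = 1\<^sup>*\<close>.\<close>

locale involutive_be_algebra = be_algebra +
  fixes star :: "'a \<Rightarrow> 'a"
  assumes star_imp_zero:
      "\<exists>zero. bounded_be_algebra X imp \<one> zero \<and> (\<forall>x\<in>X. star x = (x \<rightarrow> zero))"
    and star_star: "x \<in> X \<Longrightarrow> star (star x) = x"

locale pre_wajsberg_algebra = involutive_be_algebra +
  assumes imp_q_meet: "\<lbrakk>x \<in> X; y \<in> X\<rbrakk> \<Longrightarrow> (x \<rightarrow> q_meet imp star x y) = (x \<rightarrow> y)"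

locale wajsberg_algebra =
  fixes X :: "'a set"
    and imp :: "'a \<Rightarrow> 'a \<Rightarrow> 'a"  (infixr "\<rightarrow>" 65)
    and one :: 'a  ("\<one>")
    and star :: "'a \<Rightarrow> 'a"
  assumes imp_closed: "\<lbrakk>x \<in> X; y \<in> X\<rbrakk> \<Longrightarrow> (x \<rightarrow> y) \<in> X"
    and star_closed: "x \<in> X \<Longrightarrow> star x \<in> X"
    and one_closed: "\<one> \<in> X"
    and one_imp: "x \<in> X \<Longrightarrow> (\<one> \<rightarrow> x) = x"
    and imp_trans:
      "\<lbrakk>x \<in> X; y \<in> X; z \<in> X\<rbrakk> \<Longrightarrow> ((y \<rightarrow> z) \<rightarrow> ((z \<rightarrow> x) \<rightarrow> (y \<rightarrow> x))) = \<one>"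
    and imp_commute:
      "\<lbrakk>x \<in> X; y \<in> X\<rbrakk> \<Longrightarrow> ((x \<rightarrow> y) \<rightarrow> y) = ((y \<rightarrow> x) \<rightarrow> x)"
    and star_contrapos:
      "\<lbrakk>x \<in> X; y \<in> X\<rbrakk> \<Longrightarrow> ((star x \<rightarrow> star y) \<rightarrow> (y \<rightarrow> x)) = \<one>"

end

(* Write x \<squnion> y for (x \<rightarrow> y) \<rightarrow> y, the De Morgan dual of the meet. Contraposition turns the pre-Wajsberg
   identity into (x \<squnion> y) \<rightarrow> x = y \<rightarrow> x, and turns the order hypothesis into: x \<le> y implies y \<squnion> x = y.
   Since x \<le> x \<squnion> y always holds, x \<squnion> y = ((x \<squnion> y) \<rightarrow> x) \<rightarrow> x = (y \<rightarrow> x) \<rightarrow> x = y \<squnion> x. *)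

theory Submission
  imports Defs
begin

context involutive_be_algebra
begin

lemma star_closed: "x \<in> X \<Longrightarrow> star x \<in> X"
  using star_imp_zero bounded_be_algebra.zero_closed imp_closed by metis

text \<open>Contraposition is the exchange law in disguise: unfolding \<open>star y\<close> as
  \<open>y \<rightarrow> z\<close> with \<open>z\<close> the bottom element, \<open>y\<close> moves
  to the front and the double star on \<open>x\<close> cancels.\<close>

lemma star_imp_star:
  assumes "x \<in> X" "y \<in> X"
  shows "(star x \<rightarrow> star y) = (y \<rightarrow> x)"
proof -
  obtain z where z: "z \<in> X" and s: "\<And>u. u \<in> X \<Longrightarrow> star u = (u \<rightarrow> z)"
    using star_imp_zero bounded_be_algebra.zero_closed by metis
  have "(star x \<rightarrow> star y) = (star x \<rightarrow> (y \<rightarrow> z))"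
    using assms s by simp
  also have "\<dots> = (y \<rightarrow> (star x \<rightarrow> z))"
    using assms z star_closed by (simp add: imp_exchange)
  also have "(star x \<rightarrow> z) = x"
    using assms s star_closed star_star by metis
  finally show ?thesis .
qed

lemma q_meet_star:
  assumes "x \<in> X" "y \<in> X"
  shows "q_meet imp star (star x) (star y) = star ((x \<rightarrow> y) \<rightarrow> y)"
  using assms by (simp add: q_meet_def star_star)

text \<open>The starred form of \<open>q_le\<close> reads as an absorption law for joins, because
  \<open>star\<close> is an involution and hence injective on \<open>X\<close>.\<close>

lemma q_le_imp_join_eq:
  assumes x: "x \<in> X" and y: "y \<in> X"
    and q: "q_le imp star (star y) (star x)"
  shows "((y \<rightarrow> x) \<rightarrow> x) = y"
proof -
  have "star y = star ((y \<rightarrow> x) \<rightarrow> x)"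
    using q x y by (simp add: q_le_def q_meet_star)
  then show ?thesis
    using x y star_star imp_closed by metis
qed

end

context pre_wajsberg_algebra
begin

text \<open>This is the dual of \<open>imp_q_meet\<close>: instantiated at starred elements, its
  meet becomes a starred join, and contraposition strips the stars from both sides.\<close>

lemma join_imp_left:
  assumes x: "x \<in> X" and y: "y \<in> X"
  shows "(((x \<rightarrow> y) \<rightarrow> y) \<rightarrow> x) = (y \<rightarrow> x)"
proof -
  have "(star x \<rightarrow> star ((x \<rightarrow> y) \<rightarrow> y)) = (star x \<rightarrow> star y)"
    using imp_q_meet[of "star x" "star y"] x y by (simp add: q_meet_star star_closed)
  then show ?thesis
    using x y by (simp add: star_imp_star imp_closed)
qed

lemma wajsberg_if_join_commute:
  assumes comm: "\<And>x y. \<lbrakk>x \<in> X; y \<in> X\<rbrakk> \<Longrightarrow> ((x \<rightarrow> y) \<rightarrow> y) = ((y \<rightarrow> x) \<rightarrow> x)"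
  shows "wajsberg_algebra X imp \<one> star"
proof
  fix x y z assume x: "x \<in> X" and y: "y \<in> X" and z: "z \<in> X"
  \<comment> \<open>Exchanging exposes the join of \<open>z\<close> and \<open>x\<close>; commuting
    it and exchanging back leaves an instance of \<open>a \<rightarrow> (b \<rightarrow> a)\<close>,
    which always equals \<open>\<one>\<close>.\<close>
  have "((z \<rightarrow> x) \<rightarrow> (y \<rightarrow> x)) = (y \<rightarrow> ((z \<rightarrow> x) \<rightarrow> x))"
    using x y z by (simp add: imp_exchange imp_closed)
  also have "\<dots> = (y \<rightarrow> ((x \<rightarrow> z) \<rightarrow> z))"
    using comm x z by simp
  also have "\<dots> = ((x \<rightarrow> z) \<rightarrow> (y \<rightarrow> z))"
    using x y z by (simp add: imp_exchange imp_closed)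
  finally have "((y \<rightarrow> z) \<rightarrow> ((z \<rightarrow> x) \<rightarrow> (y \<rightarrow> x))) = ((y \<rightarrow> z) \<rightarrow> ((x \<rightarrow> z) \<rightarrow> (y \<rightarrow> z)))"
    by simp
  also have "\<dots> = ((x \<rightarrow> z) \<rightarrow> ((y \<rightarrow> z) \<rightarrow> (y \<rightarrow> z)))"
    using x y z by (intro imp_exchange imp_closed)
  also have "\<dots> = \<one>"
    using x y z by (simp add: imp_refl imp_one imp_closed)
  finally show "((y \<rightarrow> z) \<rightarrow> ((z \<rightarrow> x) \<rightarrow> (y \<rightarrow> x))) = \<one>" .
\<comment> \<open>The contraposition axiom reduces to reflexivity, since
  \<open>star_imp_star\<close> makes its two sides equal.\<close>
qed (simp_all add: imp_closed star_closed one_closed one_imp comm star_imp_star imp_refl)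

lemma join_commute_if_le_imp_q_le:
  assumes le: "\<And>x y. \<lbrakk>x \<in> X; y \<in> X; be_le imp \<one> x y\<rbrakk> \<Longrightarrow> q_le imp star x y"
    and x: "x \<in> X" and y: "y \<in> X"
  shows "((x \<rightarrow> y) \<rightarrow> y) = ((y \<rightarrow> x) \<rightarrow> x)"
proof -
  let ?j = "(x \<rightarrow> y) \<rightarrow> y"
  have j: "?j \<in> X"
    using x y by (simp add: imp_closed)
  have "(x \<rightarrow> ?j) = ((x \<rightarrow> y) \<rightarrow> (x \<rightarrow> y))"
    using x y by (intro imp_exchange imp_closed)
  \<comment> \<open>The inequality between \<open>x\<close> and \<open>?j\<close> is reversed under
    \<open>star\<close> so that the hypothesis yields the starred form required by
    \<open>q_le_imp_join_eq\<close>.\<close>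
  then have "be_le imp \<one> (star ?j) (star x)"
    using x y j by (simp add: be_le_def star_imp_star imp_refl imp_closed)
  then have "q_le imp star (star ?j) (star x)"
    using le x j star_closed by blast
  then have "((?j \<rightarrow> x) \<rightarrow> x) = ?j"
    using q_le_imp_join_eq x j by blast
  then show ?thesis
    using join_imp_left x y by simp
qed

text \<open>Contraposition gives \<open>(star y \<rightarrow> star x) = \<one>\<close>, so the
  commuted join of \<open>star x\<close> and \<open>star y\<close> collapses to
  \<open>star x\<close>; one more star turns this into the claim.\<close>

lemma le_imp_q_le_if_wajsberg:
  assumes w: "wajsberg_algebra X imp \<one> star"
    and x: "x \<in> X" and y: "y \<in> X" and le: "be_le imp \<one> x y"
  shows "q_le imp star x y"
proof -
  have "((star x \<rightarrow> star y) \<rightarrow> star y) = ((star y \<rightarrow> star x) \<rightarrow> star x)"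
    using wajsberg_algebra.imp_commute[OF w] x y star_closed by blast
  also have "\<dots> = star x"
    using x y le by (simp add: star_imp_star be_le_def one_imp star_closed)
  finally show ?thesis
    using x by (simp add: q_le_def q_meet_def star_star)
qed

end

theorem theorem4p4:
  fixes X :: "'a set"
    and imp :: "'a \<Rightarrow> 'a \<Rightarrow> 'a"
    and one :: 'a
    and star :: "'a \<Rightarrow> 'a"
  assumes "pre_wajsberg_algebra X imp one star"
  shows "wajsberg_algebra X imp one star \<longleftrightarrow>
    (\<forall>x\<in>X. \<forall>y\<in>X. be_le imp one x y \<longrightarrow> q_le imp star x y)"
proof -
  interpret pre_wajsberg_algebra X imp one star by fact
  show ?thesis
    using le_imp_q_le_if_wajsberg wajsberg_if_join_commute join_commute_if_le_imp_q_le by metis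
qed

end
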